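(* Let $F$ be a field of prime characteristic $p$, let $n\ge 1$, let $\alpha\neq 0$ be an algebraic element of degree $m$ over $F$, and set $K=F[\alpha]$. Let $f_1,\dots,f_n,g_1,\dots,g_n\in F[X]$. Then the irreducible $\mathfrak{h}(n,K)$-module $$V_{\alpha,f_1(\alpha),\dots,f_n(\alpha),g_1(\alpha),\dots,g_n(\alpha)}$$ of dimension $p^n$ over $K$ restricts to a faithful irreducible $\mathfrak{h}(n,F)$-module of dimension $p^n\times m$ over $F$.
   Context: For a field $L$ and $n\ge 1$, the Heisenberg algebra $\mathfrak{h}(n,L)$ is the Lie algebra over $L$ with basis $x_1,\dots,x_n,y_1,\dots,y_n,z$ and brackets $[x_i,y_i]=z$ for $1\le i\le n$, all other brackets between basis elements (apart from $[y_i,x_i]=-z$) being zero. For a field extension $K/F$, $\mathfrak{h}(n,F)$ is regarded as the $F$-subalgebra of $\mathfrak{h}(n,K)=\mathfrak{h}(n,F)\otimes_F K$ spanned over $F$ by these basis elements; a $\mathfrak{h}(n,K)$-module (a $K$-vector space) restricts to an $\mathfrak{h}(n,F)$-module by viewing it as an $F$-vector space. For a field $K$ of prime characteristic $p$ and $\alpha,\beta_1,\dots,\beta_n,\gamma_1,\dots,\gamma_n\in K$ with $\alpha\ne 0$, $V_{\alpha,\beta_1,\dots,\beta_n,\gamma_1,\dots,\gamma_n}$ denotes the $\mathfrak{h}(n,K)$-module $K[X_1,\dots,X_n]/(X_1^p,\dots,X_n^p)$ on which $z$ acts as $\alpha\cdot I$, $x_i$ acts as $\beta_i\cdot I+\alpha\cdot\partial/\partial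 X_i$, and $y_i$ acts as $\gamma_i\cdot I$ plus multiplication by $X_i$ (these operators on $K[X_1,\dots,X_n]$ preserve the ideal $(X_1^p,\dots,X_n^p)$). *)

theory Defs
  imports "HOL-Analysis.Analysis" "HOL-Library.Poly_Mapping"
begin

text \<open>The extension \<open>K/F\<close> is given by the embedding \<open>\<iota>\<close> of \<open>F\<close> into \<open>K\<close>; \<open>simple_ext \<iota> \<alpha>\<close> below is
  \<open>F[\<alpha>]\<close>.\<close>

locale field_extension =
  fixes \<iota> :: "'f::field \<Rightarrow> 'k::field"
  assumes hom_one: "\<iota> 1 = 1"
    and hom_add: "\<iota> (x + y) = \<iota> x + \<iota> y"
    and hom_mult: "\<iota> (x * y) = \<iota> x * \<iota> y"

definition eval_at :: "('f::field \<Rightarrow> 'k::field) \<Rightarrow> 'k \<Rightarrow> 'f poly \<Rightarrow> 'k" where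
  "eval_at \<iota> \<alpha> q = poly (map_poly \<iota> q) \<alpha>"

definition is_min_poly :: "('f::field \<Rightarrow> 'k::field) \<Rightarrow> 'k \<Rightarrow> 'f poly \<Rightarrow> bool" where
  "is_min_poly \<iota> \<alpha> q \<longleftrightarrow> lead_coeff q = 1 \<and> eval_at \<iota> \<alpha> q = 0 \<and>
     (\<forall>r. r \<noteq> 0 \<longrightarrow> eval_at \<iota> \<alpha> r = 0 \<longrightarrow> degree q \<le> degree r)"

definition algebraic_of_degree :: "('f::field \<Rightarrow> 'k::field) \<Rightarrow> 'k \<Rightarrow> nat \<Rightarrow> bool" where
  "algebraic_of_degree \<iota> \<alpha> m \<longleftrightarrow> (\<exists>q. is_min_poly \<iota> \<alpha> q \<and> degree q = m)"

definition simple_ext :: "('f::field \<Rightarrow> 'k::field) \<Rightarrow> 'k \<Rightarrow> 'k set" where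
  "simple_ext \<iota> \<alpha> = range (eval_at \<iota> \<alpha>)"

locale lie_algebra = vector_space scale
  for scale :: "'a::field \<Rightarrow> 'g::ab_group_add \<Rightarrow> 'g" +
  fixes bracket :: "'g \<Rightarrow> 'g \<Rightarrow> 'g"
  assumes bracket_linear_left: "Vector_Spaces.linear scale scale (\<lambda>x. bracket x y)"
    and bracket_linear_right: "Vector_Spaces.linear scale scale (bracket x)"
    and bracket_self: "bracket x x = 0"
    and jacobi: "bracket x (bracket y z) + bracket y (bracket z x) + bracket z (bracket x y) = 0"

locale lie_module = L: lie_algebra scaleL bracket + V: vector_space scaleV
  for scaleL :: "'a::field \<Rightarrow> 'g::ab_group_add \<Rightarrow> 'g"
    and bracket :: "'g \<Rightarrow> 'g \<Rightarrow> 'g"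
    and scaleV :: "'a \<Rightarrow> 'v::ab_group_add \<Rightarrow> 'v" +
  fixes act :: "'g \<Rightarrow> 'v \<Rightarrow> 'v"
  assumes act_linear_left: "Vector_Spaces.linear scaleL scaleV (\<lambda>x. act x v)"
    and act_linear_right: "Vector_Spaces.linear scaleV scaleV (act x)"
    and act_bracket: "act (bracket x y) v = act x (act y v) - act y (act x v)"
begin

definition submodule :: "'v set \<Rightarrow> bool" where
  "submodule W \<longleftrightarrow> V.subspace W \<and> (\<forall>x. \<forall>w\<in>W. act x w \<in> W)"

end

locale irreducible_lie_module = lie_module scaleL bracket scaleV act
  for scaleL :: "'a::field \<Rightarrow> 'g::ab_group_add \<Rightarrow> 'g"
    and bracket :: "'g \<Rightarrow> 'g \<Rightarrow> 'g"
    and scaleV :: "'a \<Rightarrow> 'v::ab_group_add \<Rightarrow> 'v"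
    and act :: "'g \<Rightarrow> 'v \<Rightarrow> 'v" +
  assumes nontrivial: "(UNIV :: 'v set) \<noteq> {0}"
    and irreducible: "submodule W \<Longrightarrow> W = {0} \<or> W = UNIV"

locale faithful_lie_module = lie_module +
  assumes faithful: "(\<forall>v. act x v = 0) \<Longrightarrow> x = 0"

definition restrict_scalars :: "('f \<Rightarrow> 'k) \<Rightarrow> ('k \<Rightarrow> 'v \<Rightarrow> 'v) \<Rightarrow> 'f \<Rightarrow> 'v \<Rightarrow> 'v" where
  "restrict_scalars \<iota> s c v = s (\<iota> c) v"

text \<open>The triple \<open>(a, b, t)\<close> stands for \<open>(\<Sum>i. a\<^sub>i x\<^sub>i) + (\<Sum>i. b\<^sub>i y\<^sub>i) + t z\<close>; the number \<open>n\<close>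
  of pairs \<open>x\<^sub>i, y\<^sub>i\<close> is the cardinality of the finite index type \<open>'n\<close>.\<close>

type_synonym ('k, 'n) heis = "('k ^ 'n) \<times> ('k ^ 'n) \<times> 'k"

definition heis_scale :: "'k::field \<Rightarrow> ('k, 'n::finite) heis \<Rightarrow> ('k, 'n) heis" where
  "heis_scale c = (\<lambda>(a, b, t). (c *s a, c *s b, c * t))"

definition heis_bracket :: "('k::field, 'n::finite) heis \<Rightarrow> ('k, 'n) heis \<Rightarrow> ('k, 'n) heis" where
  "heis_bracket = (\<lambda>(a, b, t) (a', b', t'). (0, 0, \<Sum>i\<in>UNIV. a $ i * b' $ i - b $ i * a' $ i))"

definition heis_x :: "'n::finite \<Rightarrow> ('k::field, 'n) heis" where
  "heis_x i = (axis i 1, 0, 0)"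

definition heis_y :: "'n::finite \<Rightarrow> ('k::field, 'n) heis" where
  "heis_y i = (0, axis i 1, 0)"

definition heis_z :: "('k::field, 'n::finite) heis" where
  "heis_z = (0, 0, 1)"

lemma vector_space_heis: "vector_space (heis_scale :: 'k::field \<Rightarrow> ('k, 'n::finite) heis \<Rightarrow> _)"
  by unfold_locales
    (simp_all add: heis_scale_def case_prod_beta prod_eq_iff vec_eq_iff algebra_simps)

lemma lie_algebra_heis:
  "lie_algebra (heis_scale :: 'k::field \<Rightarrow> ('k, 'n::finite) heis \<Rightarrow> _) heis_bracket"
proof -
  interpret vector_space "heis_scale :: 'k \<Rightarrow> ('k, 'n) heis \<Rightarrow> _" by (rule vector_space_heis)
  show ?thesis
    by (unfold_locales)
      (simp_all add: heis_scale_def heis_bracket_def case_prod_beta prod_eq_iff vec_eq_iff algebra_simps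
         sum.distrib sum_subtractf sum_distrib_left)
qed

lemma heis_decompose:
  "(a, b, t) = (\<Sum>i\<in>UNIV. heis_scale (a $ i) (heis_x i)) + (\<Sum>i\<in>UNIV. heis_scale (b $ i) (heis_y i))
     + heis_scale t (heis_z :: ('k::field, 'n::finite) heis)"
  by (simp add: heis_scale_def heis_x_def heis_y_def heis_z_def prod_eq_iff fst_sum snd_sum
      vec_eq_iff axis_def if_distrib cong: if_cong)

lemma heis_bracket_basis:
  "heis_bracket (heis_x i) (heis_y j) = (if i = j then heis_z else 0 :: ('k::field, 'n::finite) heis)"
  "heis_bracket (heis_x i) (heis_x j) = (0 :: ('k, 'n) heis)"
  "heis_bracket (heis_y i) (heis_y j) = (0 :: ('k, 'n) heis)"
  "heis_bracket u heis_z = 0"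
  by (simp_all add: heis_bracket_def heis_x_def heis_y_def heis_z_def zero_prod_def axis_def
      if_distrib[where f = "\<lambda>x. x * _"] if_distrib[where f = "\<lambda>x. _ * x"] case_prod_beta cong: if_cong)

definition heis_incl :: "('f::field \<Rightarrow> 'k::field) \<Rightarrow> ('f, 'n::finite) heis \<Rightarrow> ('k, 'n) heis" where
  "heis_incl \<iota> = (\<lambda>(a, b, t). (\<chi> i. \<iota> (a $ i), \<chi> i. \<iota> (b $ i), \<iota> t))"

context field_extension
begin

lemma hom_zero: "\<iota> 0 = 0"
  using hom_add[of 0 0] by (simp only: add_0_left add_cancel_right_right)

lemma hom_minus: "\<iota> (- x) = - \<iota> x"
  using hom_add[of x "- x"] by (simp add: hom_zero add_eq_0_iff)

lemma hom_sum: "\<iota> (sum u A) = (\<Sum>x\<in>A. \<iota> (u x))"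
  by (induction A rule: infinite_finite_induct) (simp_all add: hom_zero hom_add)

lemma heis_incl_basis:
  "heis_incl \<iota> (heis_x i) = heis_x i" "heis_incl \<iota> (heis_y i) = heis_y i" "heis_incl \<iota> heis_z = heis_z"
  by (simp_all add: heis_incl_def heis_x_def heis_y_def heis_z_def vec_eq_iff axis_def hom_zero hom_one)

lemma heis_incl_add: "heis_incl \<iota> (u + v) = heis_incl \<iota> u + heis_incl \<iota> v"
  by (simp add: heis_incl_def case_prod_beta vec_eq_iff hom_add)

lemma heis_incl_scale: "heis_incl \<iota> (heis_scale c u) = heis_scale (\<iota> c) (heis_incl \<iota> u)"
  by (simp add: heis_incl_def heis_scale_def case_prod_beta vec_eq_iff hom_mult)

lemma heis_incl_bracket:
  "heis_incl \<iota> (heis_bracket u v) = heis_bracket (heis_incl \<iota> u) (heis_incl \<iota> v)"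
  by (simp add: heis_incl_def heis_bracket_def case_prod_beta vec_eq_iff hom_zero hom_sum hom_add
      hom_minus hom_mult diff_conv_add_uminus del: add_uminus_conv_diff)

end

definition restrict_act ::
  "('f::field \<Rightarrow> 'k::field) \<Rightarrow> (('k, 'n::finite) heis \<Rightarrow> 'v \<Rightarrow> 'v) \<Rightarrow> ('f, 'n) heis \<Rightarrow> 'v \<Rightarrow> 'v"
where
  "restrict_act \<iota> act u = act (heis_incl \<iota> u)"

text \<open>The polynomial ring \<open>K[X\<^sub>i | i]\<close> is the monoid algebra of the exponent vectors.\<close>

type_synonym ('k, 'n) mpoly = "('n \<Rightarrow>\<^sub>0 nat) \<Rightarrow>\<^sub>0 'k"

definition mvar :: "'n \<Rightarrow> ('k::field, 'n) mpoly" where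
  "mvar i = Poly_Mapping.single (Poly_Mapping.single i 1) 1"

definition mconst :: "'k::field \<Rightarrow> ('k, 'n) mpoly" where
  "mconst c = Poly_Mapping.single 0 c"

text \<open>The subtraction of exponents truncates only where the coefficient vanishes anyway.\<close>

definition mpderiv :: "'n \<Rightarrow> ('k::field, 'n) mpoly \<Rightarrow> ('k, 'n) mpoly" where
  "mpderiv i f = (\<Sum>e\<in>Poly_Mapping.keys f. Poly_Mapping.single (e - Poly_Mapping.single i 1)
      (of_nat (Poly_Mapping.lookup e i) * Poly_Mapping.lookup f e))"

lemma mpderiv_single:
  "mpderiv i (Poly_Mapping.single e c) =
    Poly_Mapping.single (e - Poly_Mapping.single i 1) (of_nat (Poly_Mapping.lookup e i) * c)"
  by (simp add: mpderiv_def)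

lemma mpderiv_superset:
  assumes "finite A" "Poly_Mapping.keys f \<subseteq> A"
  shows "mpderiv i f = (\<Sum>e\<in>A. Poly_Mapping.single (e - Poly_Mapping.single i 1)
      (of_nat (Poly_Mapping.lookup e i) * Poly_Mapping.lookup f e))"
  unfolding mpderiv_def using assms
  by (intro sum.mono_neutral_left) (auto simp: in_keys_iff)

lemma mpderiv_add: "mpderiv i (f + g) = mpderiv i f + mpderiv i g"
proof -
  let ?A = "Poly_Mapping.keys f \<union> Poly_Mapping.keys g"
  have "finite ?A" "Poly_Mapping.keys (f + g) \<subseteq> ?A"
    by (auto simp: in_keys_iff lookup_add)
  then show ?thesis
    by (simp add: mpderiv_superset[of ?A] lookup_add distrib_left single_add sum.distrib)
qed

lemma mpderiv_0 [simp]: "mpderiv i 0 = 0"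
  by (simp add: mpderiv_def)

lemma mpderiv_minus: "mpderiv i (- f) = - mpderiv i f"
  by (metis add.right_inverse add_eq_0_iff mpderiv_0 mpderiv_add)

lemma mpderiv_diff: "mpderiv i (f - g) = mpderiv i f - mpderiv i g"
  using mpderiv_add[of i f "- g"] by (simp add: mpderiv_minus)

lemma mpoly_induct:
  fixes f :: "('k::field, 'n) mpoly"
  assumes single: "\<And>e c. P (Poly_Mapping.single e c)"
    and add: "\<And>f g. P f \<Longrightarrow> P g \<Longrightarrow> P (f + g)"
  shows "P f"
proof -
  have "P (\<Sum>e\<in>A. Poly_Mapping.single e (Poly_Mapping.lookup f e))" if "finite A" for A
    using that
  proof induction
    case empty
    show ?case using single[of 0 0] by simp
  qed (simp add: single add)
  moreover have "f = (\<Sum>e\<in>Poly_Mapping.keys f. Poly_Mapping.single e (Poly_Mapping.lookup f e))"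
    by (rule poly_mapping_eqI) (simp add: lookup_sum lookup_single when_def in_keys_iff)
  ultimately show ?thesis
    by (metis finite_keys)
qed

lemma mpderiv_mult:
  fixes f g :: "('k::field, 'n) mpoly"
  shows "mpderiv i (f * g) = mpderiv i f * g + f * mpderiv i g"
proof -
  have 1: "mpderiv i (Poly_Mapping.single k v * Poly_Mapping.single l w) =
     mpderiv i (Poly_Mapping.single k v) * Poly_Mapping.single l w +
     Poly_Mapping.single k v * mpderiv i (Poly_Mapping.single l w)"
    for k l and v w :: 'k
  proof -
    let ?e = "Poly_Mapping.single i (1::nat)"
    have shift: "a + b - ?e = (a - ?e) + b" if "Poly_Mapping.lookup a i \<noteq> 0" for a b
      using that
      by (intro poly_mapping_eqI) (auto simp: lookup_add lookup_minus lookup_single when_def)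
    have "Poly_Mapping.single (k + l - ?e) (of_nat (Poly_Mapping.lookup k i) * (v * w)) =
        Poly_Mapping.single ((k - ?e) + l) (of_nat (Poly_Mapping.lookup k i) * (v * w))"
      by (cases "Poly_Mapping.lookup k i = 0") (auto simp: shift simp del: One_nat_def)
    moreover have "Poly_Mapping.single (k + l - ?e) (of_nat (Poly_Mapping.lookup l i) * (v * w)) =
        Poly_Mapping.single (k + (l - ?e)) (of_nat (Poly_Mapping.lookup l i) * (v * w))"
      using shift[of l k]
      by (cases "Poly_Mapping.lookup l i = 0") (auto simp: add.commute simp del: One_nat_def)
    ultimately show ?thesis
      by (simp add: mult_single mpderiv_single lookup_add single_add algebra_simps)
  qed
  have 2: "mpderiv i (f * Poly_Mapping.single l w) =
      mpderiv i f * Poly_Mapping.single l w + f * mpderiv i (Poly_Mapping.single l w)" for l w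
    by (induction f rule: mpoly_induct)
      (simp_all only: 1 distrib_right mpderiv_add add_ac)
  show ?thesis
    by (induction g rule: mpoly_induct)
      (simp_all only: 2 distrib_left mpderiv_add add_ac)
qed

text \<open>The ideal generated by the \<open>X\<^sub>i\<^sup>p\<close>, where \<open>p\<close> is the characteristic of the coefficient field.\<close>

definition trunc_ideal :: "('k::field, 'n) mpoly set" where
  "trunc_ideal = module.span (*) (range (\<lambda>i. mvar i ^ CHAR('k)))"

interpretation mult_module: module "(*) :: 'a::comm_ring_1 \<Rightarrow> 'a \<Rightarrow> 'a"
  by unfold_locales (simp_all add: algebra_simps)

lemma trunc_ideal_closed:
  "0 \<in> trunc_ideal"
  "f \<in> trunc_ideal \<Longrightarrow> g \<in> trunc_ideal \<Longrightarrow> f + g \<in> trunc_ideal"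
  "f \<in> trunc_ideal \<Longrightarrow> g \<in> trunc_ideal \<Longrightarrow> f - g \<in> trunc_ideal"
  "f \<in> trunc_ideal \<Longrightarrow> - f \<in> trunc_ideal"
  "f \<in> trunc_ideal \<Longrightarrow> h * f \<in> trunc_ideal"
  unfolding trunc_ideal_def
  by (fact mult_module.span_zero mult_module.span_add mult_module.span_diff
      mult_module.span_neg mult_module.span_scale)+

lemma mvar_power: "mvar i ^ m = Poly_Mapping.single (Poly_Mapping.single i m) 1"
  by (induction m) (simp_all add: mvar_def mult_single flip: single_add)

lemma trunc_ideal_mpderiv:
  assumes "f \<in> (trunc_ideal :: ('k::field, 'n) mpoly set)"
  shows "mpderiv i f \<in> trunc_ideal"
  using assms unfolding trunc_ideal_def
proof (induction rule: mult_module.span_induct_alt)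
  case base
  show ?case by (simp add: mult_module.span_zero)
next
  case (step c x y)
  then obtain j where x: "x = mvar j ^ CHAR('k)" by auto
  have "mpderiv i x = 0"
    by (cases "i = j") (simp_all add: x mvar_power mpderiv_single lookup_single)
  then have "mpderiv i (c * x + y) = mpderiv i c * x + mpderiv i y"
    by (simp add: mpderiv_add mpderiv_mult)
  with step show ?case
    by (simp add: mult_module.span_add mult_module.span_scale mult_module.span_base)
qed

definition trunc_rel :: "('k::field, 'n) mpoly \<Rightarrow> ('k, 'n) mpoly \<Rightarrow> bool" where
  "trunc_rel f g \<longleftrightarrow> f - g \<in> trunc_ideal"

lemma trunc_relI:
  "(\<And>f g :: ('k::field, 'n) mpoly. trunc_rel f g \<Longrightarrow> trunc_rel (F f) (F g))"
  if "\<And>f g :: ('k, 'n) mpoly. F (f - g) = F f - F g"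
    and "\<And>f :: ('k, 'n) mpoly. f \<in> trunc_ideal \<Longrightarrow> F f \<in> trunc_ideal"
  using that unfolding trunc_rel_def by metis

quotient_type (overloaded) ('k, 'n) trunc_poly = "('k::field, 'n) mpoly" / trunc_rel
proof (rule equivpI)
  show "reflp (trunc_rel :: ('k, 'n) mpoly \<Rightarrow> _)"
    by (simp add: reflp_def trunc_rel_def trunc_ideal_closed)
  show "symp (trunc_rel :: ('k, 'n) mpoly \<Rightarrow> _)"
    unfolding symp_def trunc_rel_def using trunc_ideal_closed(4) by (metis minus_diff_eq)
  show "transp (trunc_rel :: ('k, 'n) mpoly \<Rightarrow> _)"
  proof (rule transpI)
    fix f g h :: "('k, 'n) mpoly"
    assume "trunc_rel f g" "trunc_rel g h"
    then have "(f - g) + (g - h) \<in> trunc_ideal"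
      unfolding trunc_rel_def by (rule trunc_ideal_closed(2))
    then show "trunc_rel f h"
      by (simp add: trunc_rel_def)
  qed
qed

instantiation trunc_poly :: (field, type) ab_group_add
begin

lift_definition zero_trunc_poly :: "('a, 'b) trunc_poly" is 0 .

lift_definition plus_trunc_poly :: "('a, 'b) trunc_poly \<Rightarrow> ('a, 'b) trunc_poly \<Rightarrow> ('a, 'b) trunc_poly"
  is "(+)"
  unfolding trunc_rel_def add_diff_add by (rule trunc_ideal_closed(2))

lift_definition uminus_trunc_poly :: "('a, 'b) trunc_poly \<Rightarrow> ('a, 'b) trunc_poly" is uminus
  by (rule trunc_relI) (simp_all add: trunc_ideal_closed)

lift_definition minus_trunc_poly :: "('a, 'b) trunc_poly \<Rightarrow> ('a, 'b) trunc_poly \<Rightarrow> ('a, 'b) trunc_poly"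
  is "(-)"
proof -
  fix f f' g g' :: "('a, 'b) mpoly"
  assume "trunc_rel f f'" "trunc_rel g g'"
  then have "(f - f') - (g - g') \<in> trunc_ideal"
    unfolding trunc_rel_def by (rule trunc_ideal_closed(3))
  then show "trunc_rel (f - g) (f' - g')"
    by (simp add: trunc_rel_def algebra_simps)
qed

instance
proof
  fix u v w :: "('a, 'b) trunc_poly"
  show "u + v + w = u + (v + w)" by transfer (simp add: trunc_rel_def trunc_ideal_closed add_ac)
  show "u + v = v + u" by transfer (simp add: trunc_rel_def trunc_ideal_closed add_ac)
  show "0 + u = u" by transfer (simp add: trunc_rel_def trunc_ideal_closed)
  show "- u + u = 0" by transfer (simp add: trunc_rel_def trunc_ideal_closed)
  show "u - v = u + - v" by transfer (simp add: trunc_rel_def trunc_ideal_closed)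
qed

end

lift_definition trunc_scale :: "'k::field \<Rightarrow> ('k, 'n) trunc_poly \<Rightarrow> ('k, 'n) trunc_poly"
  is "\<lambda>c f. mconst c * f"
  by (rule trunc_relI) (simp_all add: trunc_ideal_closed right_diff_distrib)

lemma vector_space_trunc: "vector_space (trunc_scale :: 'k::field \<Rightarrow> ('k, 'n) trunc_poly \<Rightarrow> _)"
proof
  fix a b :: 'k and x y :: "('k, 'n) trunc_poly"
  show "trunc_scale a (x + y) = trunc_scale a x + trunc_scale a y"
    by transfer (simp add: trunc_rel_def trunc_ideal_closed distrib_left)
  show "trunc_scale (a + b) x = trunc_scale a x + trunc_scale b x"
    by transfer (simp add: trunc_rel_def trunc_ideal_closed mconst_def single_add distrib_right)
  show "trunc_scale a (trunc_scale b x) = trunc_scale (a * b) x"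
    by transfer (simp add: trunc_rel_def trunc_ideal_closed mconst_def mult_single flip: mult.assoc)
  show "trunc_scale 1 x = x"
    by transfer (simp add: trunc_rel_def trunc_ideal_closed mconst_def)
qed

lift_definition trunc_mvar :: "'n \<Rightarrow> ('k::field, 'n) trunc_poly \<Rightarrow> ('k, 'n) trunc_poly"
  is "\<lambda>i f. mvar i * f"
  by (rule trunc_relI) (simp_all add: trunc_ideal_closed right_diff_distrib)

lift_definition trunc_pderiv :: "'n \<Rightarrow> ('k::field, 'n) trunc_poly \<Rightarrow> ('k, 'n) trunc_poly"
  is mpderiv
  by (rule trunc_relI) (simp_all add: mpderiv_diff trunc_ideal_mpderiv)

definition heis_act ::
  "'k::field \<Rightarrow> ('n::finite \<Rightarrow> 'k) \<Rightarrow> ('n \<Rightarrow> 'k) \<Rightarrow> ('k, 'n) heis \<Rightarrow> ('k, 'n) trunc_poly \<Rightarrow> ('k, 'n) trunc_poly"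
where
  "heis_act \<alpha> \<beta> \<gamma> = (\<lambda>(a, b, t) v.
     (\<Sum>i\<in>UNIV. trunc_scale (a $ i) (trunc_scale (\<beta> i) v + trunc_scale \<alpha> (trunc_pderiv i v)))
   + (\<Sum>i\<in>UNIV. trunc_scale (b $ i) (trunc_scale (\<gamma> i) v + trunc_mvar i v))
   + trunc_scale t (trunc_scale \<alpha> v))"

lemma heis_act_basis:
  "heis_act \<alpha> \<beta> \<gamma> (heis_x i) v = trunc_scale (\<beta> i) v + trunc_scale \<alpha> (trunc_pderiv i v)"
  "heis_act \<alpha> \<beta> \<gamma> (heis_y i) v = trunc_scale (\<gamma> i) v + trunc_mvar i v"
  "heis_act \<alpha> \<beta> \<gamma> heis_z v = trunc_scale \<alpha> v"
proof -
  interpret vector_space "trunc_scale :: 'a \<Rightarrow> ('a, 'b) trunc_poly \<Rightarrow> _"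
    by (rule vector_space_trunc)
  have *: "(\<Sum>j\<in>UNIV. trunc_scale (axis i 1 $ j) (h j)) = h i" for h :: "'b \<Rightarrow> ('a, 'b) trunc_poly"
    by (subst sum.remove[of _ i]) (auto simp: axis_def intro!: sum.neutral)
  show "heis_act \<alpha> \<beta> \<gamma> (heis_x i) v = trunc_scale (\<beta> i) v + trunc_scale \<alpha> (trunc_pderiv i v)"
    "heis_act \<alpha> \<beta> \<gamma> (heis_y i) v = trunc_scale (\<gamma> i) v + trunc_mvar i v"
    "heis_act \<alpha> \<beta> \<gamma> heis_z v = trunc_scale \<alpha> v"
    by (simp_all add: heis_act_def heis_x_def heis_y_def heis_z_def *)
qed

end

theory Submission
  imports Defs
begin

text \<open>The monomials \<open>X\<^sup>e\<close> with all exponents below \<open>p\<close> form a \<open>K\<close>-basis of the truncated polynomial ring,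
  and their products with \<open>1, \<alpha>, \<dots>, \<alpha>\<^sup>m\<^sup>-\<^sup>1\<close> an \<open>F\<close>-basis. Since \<open>z\<close> acts by multiplication by \<open>\<alpha>\<close>,
  an \<open>F\<close>-submodule is stable under \<open>F[\<alpha>] = K\<close>, hence under every \<open>\<partial>/\<partial>X\<^sub>i\<close> and every multiplication
  by \<open>X\<^sub>i\<close>. Derivatives lead from a nonzero element of such a subspace to a nonzero constant (the
  exponents below \<open>p\<close> are invertible in \<open>K\<close>), and multiplications from there to all monomials.\<close>

section \<open>Exponent vectors with all entries below p\<close>

definition trunc_exps :: "nat \<Rightarrow> ('n \<Rightarrow>\<^sub>0 nat) set" where
  "trunc_exps p = {e. \<forall>i. Poly_Mapping.lookup e i < p}"

text \<open>Over the finite type \<open>'n\<close> every function has finite support, so exponent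
  vectors are plain functions; finiteness and the count p^n are then those of a function
  space.\<close>

lemma bij_betw_lookup_trunc_exps:
  "bij_betw Poly_Mapping.lookup (trunc_exps p :: ('n::finite \<Rightarrow>\<^sub>0 nat) set) (UNIV \<rightarrow>\<^sub>E {..<p})"
proof (rule bij_betwI')
  fix h :: "'n \<Rightarrow> nat"
  assume h: "h \<in> UNIV \<rightarrow>\<^sub>E {..<p}"
  have "Poly_Mapping.lookup (Abs_poly_mapping h) = h"
    by (rule lookup_Abs_poly_mapping) simp
  with h show "\<exists>e\<in>trunc_exps p. h = Poly_Mapping.lookup e"
    by (intro bexI[of _ "Abs_poly_mapping h"]) (auto simp: trunc_exps_def PiE_iff)
qed (auto simp: trunc_exps_def PiE_iff)

lemma finite_trunc_exps: "finite (trunc_exps p :: ('n::finite \<Rightarrow>\<^sub>0 nat) set)"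
  using bij_betw_finite[OF bij_betw_lookup_trunc_exps[where 'n = 'n]] by (simp add: finite_PiE)

lemma card_trunc_exps: "card (trunc_exps p :: ('n::finite \<Rightarrow>\<^sub>0 nat) set) = p ^ CARD('n)"
  using bij_betw_same_card[OF bij_betw_lookup_trunc_exps[where 'n = 'n]] by (simp add: card_PiE)

section \<open>Coefficients of derivatives and membership in the truncation ideal\<close>

text \<open>Lowering the i-th exponent is injective on exponents with positive i-th entry, and all
  others contribute coefficient 0. Hence at most one term of \<open>f\<close> reaches
  \<open>e\<close>.\<close>

lemma lookup_mpderiv:
  fixes f :: "('k::field, 'n) mpoly"
  shows "Poly_Mapping.lookup (mpderiv i f) e =
    of_nat (Suc (Poly_Mapping.lookup e i)) * Poly_Mapping.lookup f (e + Poly_Mapping.single i 1)"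
proof (induction f rule: mpoly_induct)
  fix e' :: "'n \<Rightarrow>\<^sub>0 nat" and c :: 'k
  have "e' - Poly_Mapping.single i 1 = e \<longleftrightarrow> e' = e + Poly_Mapping.single i 1"
    if "Poly_Mapping.lookup e' i \<noteq> 0"
  proof
    assume "e' - Poly_Mapping.single i 1 = e"
    then show "e' = e + Poly_Mapping.single i 1"
      using that by (auto intro!: poly_mapping_eqI simp: lookup_add lookup_minus lookup_single when_def)
  qed simp
  then show "Poly_Mapping.lookup (mpderiv i (Poly_Mapping.single e' c)) e =
    of_nat (Suc (Poly_Mapping.lookup e i)) *
    Poly_Mapping.lookup (Poly_Mapping.single e' c) (e + Poly_Mapping.single i 1)"
    by (cases "Poly_Mapping.lookup e' i = 0")
      (auto simp: mpderiv_single lookup_single when_def lookup_add simp del: One_nat_def)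
qed (simp add: mpderiv_add lookup_add algebra_simps)

lemma mpderiv_commute: "mpderiv i (mpderiv j f) = mpderiv j (mpderiv i f)"
  by (cases "i = j", simp, rule poly_mapping_eqI)
    (simp add: lookup_mpderiv lookup_add lookup_single mult.left_commute add.assoc
      add.commute[of "Poly_Mapping.single i _"] del: of_nat_Suc One_nat_def)

lemma mpderiv_mvar: "mpderiv i (mvar j) = (if i = j then 1 else 0)"
  by (auto simp: mvar_def mpderiv_single lookup_single when_def)

lemma mpderiv_mconst: "mpderiv i (mconst c) = 0"
  by (simp add: mconst_def mpderiv_single)

text \<open>Every monomial of a multiple of X_j^p has j-th exponent at least p; conversely, a
  monomial with such an exponent is divisible by X_j^p. The ideal is thus the K-span of these
  monomials, which makes the quotient accessible through coefficients.\<close>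

lemma mem_trunc_ideal_iff:
  fixes f :: "('k::field, 'n) mpoly"
  shows "f \<in> trunc_ideal \<longleftrightarrow> (\<forall>e\<in>trunc_exps CHAR('k). Poly_Mapping.lookup f e = 0)"
proof
  assume "f \<in> trunc_ideal"
  then show "\<forall>e\<in>trunc_exps CHAR('k). Poly_Mapping.lookup f e = 0"
    unfolding trunc_ideal_def
  proof (induction rule: mult_module.span_induct_alt)
    case (step c x y)
    then obtain j where x: "x = mvar j ^ CHAR('k)" by auto
    have "Poly_Mapping.lookup (c * x) e = 0" if "e \<in> trunc_exps CHAR('k)" for e
      using that unfolding x mvar_power
      by (induction c rule: mpoly_induct)
        (auto simp: mult_single lookup_single when_def lookup_add distrib_right trunc_exps_def
          dest!: spec[of _ j])
    with step show ?case by (simp add: lookup_add)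
  qed simp
next
  assume zero: "\<forall>e\<in>trunc_exps CHAR('k). Poly_Mapping.lookup f e = 0"
  have mem: "Poly_Mapping.single e c \<in> trunc_ideal" if e: "e \<notin> trunc_exps CHAR('k)" for e and c :: 'k
  proof -
    obtain i where i: "CHAR('k) \<le> Poly_Mapping.lookup e i"
      using e by (auto simp: trunc_exps_def not_less)
    have "e - Poly_Mapping.single i CHAR('k) + Poly_Mapping.single i CHAR('k) = e"
      using i by (intro poly_mapping_eqI) (auto simp: lookup_add lookup_minus lookup_single when_def)
    then have "Poly_Mapping.single e c =
        Poly_Mapping.single (e - Poly_Mapping.single i CHAR('k)) c * mvar i ^ CHAR('k)"
      by (simp add: mvar_power mult_single)
    then show ?thesis
      by (simp add: trunc_ideal_def mult_module.span_scale mult_module.span_base)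
  qed
  have "f = (\<Sum>e\<in>Poly_Mapping.keys f. Poly_Mapping.single e (Poly_Mapping.lookup f e))"
    by (rule poly_mapping_eqI) (simp add: lookup_sum lookup_single when_def in_keys_iff)
  also have "\<dots> \<in> trunc_ideal"
    unfolding trunc_ideal_def
    by (intro mult_module.span_sum) (use zero mem in \<open>auto simp: trunc_ideal_def in_keys_iff\<close>)
  finally show "f \<in> trunc_ideal" .
qed

text \<open>Otherwise exponent vectors, too, would be replaced by their representing functions.\<close>

lifting_forget poly_mapping.lifting

section \<open>Coordinates on the quotient\<close>

text \<open>Outside \<open>trunc_exps CHAR('k)\<close> a coefficient depends on the representative;
  the default 0 makes the function well defined on classes.\<close>

lift_definition trunc_coeff :: "('k::field, 'n) trunc_poly \<Rightarrow> ('n \<Rightarrow>\<^sub>0 nat) \<Rightarrow> 'k"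
  is "\<lambda>f e. if e \<in> trunc_exps CHAR('k) then Poly_Mapping.lookup f e else 0"
  by (auto simp: trunc_rel_def mem_trunc_ideal_iff lookup_minus)

text \<open>Exponents of size p or more are allowed and give the zero class, so that multiplication
  by a variable shifts the exponent without side condition.\<close>

lift_definition trunc_monom :: "('n \<Rightarrow>\<^sub>0 nat) \<Rightarrow> ('k::field, 'n) trunc_poly"
  is "\<lambda>e. Poly_Mapping.single e 1" .

lemma trunc_poly_eqI:
  fixes u v :: "('k::field, 'n) trunc_poly"
  assumes "\<And>e. e \<in> trunc_exps CHAR('k) \<Longrightarrow> trunc_coeff u e = trunc_coeff v e"
  shows "u = v"
proof -
  have "trunc_coeff u e = trunc_coeff v e" for e
  proof (cases "e \<in> trunc_exps CHAR('k)")
    case False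
    then have "trunc_coeff w e = 0" for w :: "('k, 'n) trunc_poly"
      by transfer simp
    then show ?thesis by simp
  qed (rule assms)
  then have "\<forall>e. trunc_coeff u e = trunc_coeff v e" by simp
  then show "u = v"
    by transfer (auto simp: trunc_rel_def mem_trunc_ideal_iff lookup_minus split: if_splits)
qed

lemma trunc_coeff_0 [simp]: "trunc_coeff 0 e = 0"
  by transfer simp

lemma trunc_coeff_add: "trunc_coeff (u + v) e = trunc_coeff u e + trunc_coeff v e"
  by transfer (simp add: lookup_add)

lemma trunc_coeff_sum: "trunc_coeff (sum h A) e = (\<Sum>x\<in>A. trunc_coeff (h x) e)"
  by (induction A rule: infinite_finite_induct) (simp_all add: trunc_coeff_add)

lemma lookup_mconst_mult: "Poly_Mapping.lookup (mconst c * f) e = c * Poly_Mapping.lookup f e"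
proof (induction f rule: mpoly_induct)
  fix e' and d :: 'a
  show "Poly_Mapping.lookup (mconst c * Poly_Mapping.single e' d) e =
      c * Poly_Mapping.lookup (Poly_Mapping.single e' d) e"
    by (simp add: mconst_def mult_single lookup_single when_def)
qed (simp only: lookup_add distrib_left)

lemma trunc_coeff_scale: "trunc_coeff (trunc_scale c v) e = c * trunc_coeff v e"
  by transfer (simp add: lookup_mconst_mult)

text \<open>At an exponent \<open>e\<close> with \<open>e\<^sub>i = p - 1\<close> the factor \<open>e\<^sub>i + 1\<close> vanishes in the field.\<close>

lemma trunc_coeff_pderiv:
  fixes v :: "('k::field, 'n) trunc_poly"
  assumes "e \<in> trunc_exps CHAR('k)"
  shows "trunc_coeff (trunc_pderiv i v) e =
    of_nat (Suc (Poly_Mapping.lookup e i)) * trunc_coeff v (e + Poly_Mapping.single i 1)"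
proof -
  have "of_nat (Suc (Poly_Mapping.lookup e i)) = (0 :: 'k)"
    if e: "e + Poly_Mapping.single i 1 \<notin> trunc_exps CHAR('k)"
  proof -
    obtain j where j: "Poly_Mapping.lookup (e + Poly_Mapping.single i 1) j \<ge> CHAR('k)"
      using e by (auto simp: trunc_exps_def not_less)
    moreover have "Poly_Mapping.lookup e j < CHAR('k)"
      using assms by (simp add: trunc_exps_def)
    ultimately have "Suc (Poly_Mapping.lookup e i) = CHAR('k)"
      by (cases "i = j") (auto simp: lookup_add lookup_single)
    then show ?thesis by (metis of_nat_CHAR)
  qed
  with assms show ?thesis
    by transfer (auto simp: lookup_mpderiv)
qed

lemma trunc_coeff_monom:
  "trunc_coeff (trunc_monom e :: ('k::field, 'n) trunc_poly) e' =
    (if e = e' \<and> e' \<in> trunc_exps CHAR('k) then 1 else 0)"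
  by transfer (simp add: lookup_single when_def)

lemma trunc_mvar_monom: "trunc_mvar i (trunc_monom e) = trunc_monom (e + Poly_Mapping.single i 1)"
  by transfer (simp add: mvar_def mult_single add.commute trunc_rel_def trunc_ideal_closed)

lemma trunc_poly_expand:
  fixes v :: "('k::field, 'n::finite) trunc_poly"
  shows "v = (\<Sum>e\<in>trunc_exps CHAR('k). trunc_scale (trunc_coeff v e) (trunc_monom e))"
  by (rule trunc_poly_eqI)
    (simp add: trunc_coeff_sum trunc_coeff_scale trunc_coeff_monom finite_trunc_exps
      if_distrib[where f = "\<lambda>x. _ * x"] cong: if_cong)

section \<open>Operators on the quotient and their commutation relations\<close>

lemma trunc_mvar_add: "trunc_mvar i (u + v) = trunc_mvar i u + trunc_mvar i v"
  by transfer (simp add: trunc_rel_def trunc_ideal_closed distrib_left)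

lemma trunc_mvar_scale: "trunc_mvar i (trunc_scale c v) = trunc_scale c (trunc_mvar i v)"
  by transfer (simp add: trunc_rel_def trunc_ideal_closed mult.left_commute)

lemma trunc_mvar_commute: "trunc_mvar i (trunc_mvar j v) = trunc_mvar j (trunc_mvar i v)"
  by transfer (simp add: trunc_rel_def trunc_ideal_closed mult.left_commute)

lemma trunc_pderiv_add: "trunc_pderiv i (u + v) = trunc_pderiv i u + trunc_pderiv i v"
  by transfer (simp add: trunc_rel_def trunc_ideal_closed mpderiv_add)

lemma trunc_pderiv_scale: "trunc_pderiv i (trunc_scale c v) = trunc_scale c (trunc_pderiv i v)"
  by transfer (simp add: trunc_rel_def trunc_ideal_closed mpderiv_mult mpderiv_mconst)

lemma trunc_pderiv_commute: "trunc_pderiv i (trunc_pderiv j v) = trunc_pderiv j (trunc_pderiv i v)"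
  by transfer (simp add: trunc_rel_def trunc_ideal_closed mpderiv_commute)

text \<open>The product rule in the form of the canonical commutation relation, the source of
  [x_i, y_i] = z.\<close>

lemma trunc_pderiv_mvar:
  "trunc_pderiv i (trunc_mvar j v) = trunc_mvar j (trunc_pderiv i v) + (if i = j then v else 0)"
  by transfer (simp add: trunc_rel_def trunc_ideal_closed mpderiv_mult mpderiv_mvar)

global_interpretation trunc: vector_space "trunc_scale :: 'k::field \<Rightarrow> ('k, 'n) trunc_poly \<Rightarrow> _"
  by (rule vector_space_trunc)

section \<open>The Lie module structure\<close>

text \<open>Every Heisenberg element acts as a scalar plus a \<open>der_part\<close> plus a
  \<open>mul_part\<close>. Operators of the same kind commute, so only the mixed terms enter a
  commutator.\<close>

definition der_part ::
  "('n::finite \<Rightarrow> 'k::field) \<Rightarrow> ('k, 'n) trunc_poly \<Rightarrow> ('k, 'n) trunc_poly" where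
  "der_part a v = (\<Sum>i\<in>UNIV. trunc_scale (a i) (trunc_pderiv i v))"

definition mul_part ::
  "('n::finite \<Rightarrow> 'k::field) \<Rightarrow> ('k, 'n) trunc_poly \<Rightarrow> ('k, 'n) trunc_poly" where
  "mul_part b v = (\<Sum>i\<in>UNIV. trunc_scale (b i) (trunc_mvar i v))"

text \<open>Packaging operators as \<open>module_hom\<close> provides \<open>module_hom.sum\<close>,
  which carries them through the double sums below.\<close>

lemma trunc_homI:
  assumes "\<And>u v. h (u + v) = h u + h v" and "\<And>c v. h (trunc_scale c v) = trunc_scale c (h v)"
  shows "module_hom trunc_scale trunc_scale h"
  by (intro module_hom.intro module_hom_axioms.intro trunc.module_axioms assms)

lemma module_hom_trunc_mvar: "module_hom trunc_scale trunc_scale (trunc_mvar i)"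
  by (rule trunc_homI) (simp_all add: trunc_mvar_add trunc_mvar_scale)

lemma module_hom_trunc_pderiv: "module_hom trunc_scale trunc_scale (trunc_pderiv i)"
  by (rule trunc_homI) (simp_all add: trunc_pderiv_add trunc_pderiv_scale)

lemma module_hom_der_part: "module_hom trunc_scale trunc_scale (der_part a)"
  by (rule trunc_homI)
    (simp_all add: der_part_def trunc_pderiv_add trunc_pderiv_scale trunc.scale_right_distrib
      sum.distrib trunc.scale_sum_right mult.commute)

lemma module_hom_mul_part: "module_hom trunc_scale trunc_scale (mul_part b)"
  by (rule trunc_homI)
    (simp_all add: mul_part_def trunc_mvar_add trunc_mvar_scale trunc.scale_right_distrib
      sum.distrib trunc.scale_sum_right mult.commute)

lemmas trunc_linear_simps =
  module_hom.add[OF module_hom_der_part] module_hom.scale[OF module_hom_der_part]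
  module_hom.add[OF module_hom_mul_part] module_hom.scale[OF module_hom_mul_part]

lemma der_part_commute: "der_part a (der_part a' v) = der_part a' (der_part a v)"
proof -
  have *: "der_part a (der_part a' v) =
    (\<Sum>i\<in>UNIV. \<Sum>j\<in>UNIV. trunc_scale (a i * a' j) (trunc_pderiv i (trunc_pderiv j v)))" for a a'
    by (simp add: der_part_def module_hom.sum[OF module_hom_trunc_pderiv]
        trunc_pderiv_scale trunc.scale_sum_right)
  show ?thesis
    unfolding * by (subst sum.swap) (simp add: mult.commute trunc_pderiv_commute)
qed

lemma mul_part_commute: "mul_part b (mul_part b' v) = mul_part b' (mul_part b v)"
proof -
  have *: "mul_part b (mul_part b' v) =
    (\<Sum>i\<in>UNIV. \<Sum>j\<in>UNIV. trunc_scale (b i * b' j) (trunc_mvar i (trunc_mvar j v)))" for b b'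
    by (simp add: mul_part_def module_hom.sum[OF module_hom_trunc_mvar]
        trunc_mvar_scale trunc.scale_sum_right)
  show ?thesis
    unfolding * by (subst sum.swap) (simp add: mult.commute trunc_mvar_commute)
qed

text \<open>Each derivative is moved past each variable; the extra terms live on the diagonal i = j
  and add up to the pairing of the coefficient vectors.\<close>

lemma der_part_mul_part:
  "der_part a (mul_part b v) = mul_part b (der_part a v) + trunc_scale (\<Sum>i\<in>UNIV. a i * b i) v"
proof -
  have "der_part a (mul_part b v) =
    (\<Sum>i\<in>UNIV. \<Sum>j\<in>UNIV. trunc_scale (a i * b j) (trunc_pderiv i (trunc_mvar j v)))"
    by (simp add: der_part_def mul_part_def module_hom.sum[OF module_hom_trunc_pderiv]
        trunc_pderiv_scale trunc.scale_sum_right)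
  also have "\<dots> = (\<Sum>i\<in>UNIV. \<Sum>j\<in>UNIV. trunc_scale (a i * b j) (trunc_mvar j (trunc_pderiv i v)))
      + (\<Sum>i\<in>UNIV. \<Sum>j\<in>UNIV. trunc_scale (a i * b j) (if i = j then v else 0))"
    by (simp add: trunc_pderiv_mvar trunc.scale_right_distrib sum.distrib)
  also have "(\<Sum>i\<in>UNIV. \<Sum>j\<in>UNIV. trunc_scale (a i * b j) (trunc_mvar j (trunc_pderiv i v)))
      = (\<Sum>j\<in>UNIV. \<Sum>i\<in>UNIV. trunc_scale (a i * b j) (trunc_mvar j (trunc_pderiv i v)))"
    by (rule sum.swap)
  also have "\<dots> = mul_part b (der_part a v)"
    by (simp add: der_part_def mul_part_def module_hom.sum[OF module_hom_trunc_mvar]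
        trunc_mvar_scale trunc.scale_sum_right mult.commute)
  also have "(\<Sum>i\<in>UNIV. \<Sum>j\<in>UNIV. trunc_scale (a i * b j) (if i = j then v else 0))
      = trunc_scale (\<Sum>i\<in>UNIV. a i * b i) v"
    by (simp add: if_distrib[where f = "trunc_scale _"] trunc.scale_sum_left cong: if_cong)
  finally show ?thesis .
qed

lemma heis_act_eq:
  "heis_act \<alpha> \<beta> \<gamma> (a, b, t) v =
    trunc_scale ((\<Sum>i\<in>UNIV. a $ i * \<beta> i) + (\<Sum>i\<in>UNIV. b $ i * \<gamma> i) + t * \<alpha>) v
    + der_part (\<lambda>i. a $ i * \<alpha>) v + mul_part (\<lambda>i. b $ i) v"
  by (simp add: heis_act_def der_part_def mul_part_def trunc.scale_right_distrib
      trunc.scale_left_distrib trunc.scale_sum_left sum.distrib add_ac)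

text \<open>Scalars commute with everything, so \<open>c\<close> and \<open>c'\<close> cancel; what
  remains is the difference of two instances of \<open>der_part_mul_part\<close>.\<close>

lemma commutator_parts:
  fixes c c' :: "'k::field" and a b a' b' :: "'n::finite \<Rightarrow> 'k"
  defines "P \<equiv> \<lambda>v. trunc_scale c v + der_part a v + mul_part b v"
    and "Q \<equiv> \<lambda>v. trunc_scale c' v + der_part a' v + mul_part b' v"
  shows "P (Q v) - Q (P v) = trunc_scale ((\<Sum>i\<in>UNIV. a i * b' i) - (\<Sum>i\<in>UNIV. a' i * b i)) v"
  unfolding P_def Q_def
  by (simp add: trunc_linear_simps trunc.scale_right_distrib trunc.scale_left_diff_distrib
      der_part_mul_part mul_part_commute der_part_commute mult.commute[of c c'])

lemma lie_module_heis_act: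
  "lie_module heis_scale heis_bracket trunc_scale (heis_act \<alpha> \<beta> \<gamma>)"
proof -
  interpret H: lie_algebra "heis_scale :: 'a \<Rightarrow> ('a, 'b) heis \<Rightarrow> _" heis_bracket
    by (rule lie_algebra_heis)
  show ?thesis
  proof
    fix x y :: "('a, 'b) heis" and v w :: "('a, 'b) trunc_poly" and c :: 'a
    obtain a b t where x: "x = (a, b, t)" by (cases x)
    obtain a' b' t' where y: "y = (a', b', t')" by (cases y)
    show "heis_act \<alpha> \<beta> \<gamma> (x + y) v = heis_act \<alpha> \<beta> \<gamma> x v + heis_act \<alpha> \<beta> \<gamma> y v"
      by (simp add: x y heis_act_def trunc.scale_left_distrib sum.distrib distrib_right add_ac)
    show "heis_act \<alpha> \<beta> \<gamma> (heis_scale c x) v = trunc_scale c (heis_act \<alpha> \<beta> \<gamma> x v)"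
      by (simp only: x heis_act_def heis_scale_def prod.case trunc.scale_right_distrib
          trunc.scale_sum_right trunc.scale_scale vector_smult_component mult.assoc)
    show "heis_act \<alpha> \<beta> \<gamma> x (v + w) = heis_act \<alpha> \<beta> \<gamma> x v + heis_act \<alpha> \<beta> \<gamma> x w"
      by (simp add: x heis_act_eq trunc_linear_simps trunc.scale_right_distrib add_ac)
    show "heis_act \<alpha> \<beta> \<gamma> x (trunc_scale c v) = trunc_scale c (heis_act \<alpha> \<beta> \<gamma> x v)"
      by (simp add: x heis_act_eq trunc_linear_simps trunc.scale_right_distrib mult.commute)
    have 0: "heis_bracket x y = (0, 0, \<Sum>i\<in>UNIV. a $ i * b' $ i - b $ i * a' $ i)"
      by (simp add: x y heis_bracket_def)
    \<comment> \<open>A bracket is a multiple of z and therefore acts by a scalar.\<close>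
    have "heis_act \<alpha> \<beta> \<gamma> (heis_bracket x y) v
        = trunc_scale ((\<Sum>i\<in>UNIV. a $ i * b' $ i - b $ i * a' $ i) * \<alpha>) v"
      unfolding 0 by (simp add: heis_act_def)
    \<comment> \<open>The factor \<alpha> is absorbed into \<open>a\<close> and \<open>a'\<close>,
      since \<open>heis_act_eq\<close> has \<open>a $ i * \<alpha>\<close> as coefficients of the
      derivatives.\<close>
    also have "(\<Sum>i\<in>UNIV. a $ i * b' $ i - b $ i * a' $ i) * \<alpha>
        = (\<Sum>i\<in>UNIV. a $ i * \<alpha> * b' $ i) - (\<Sum>i\<in>UNIV. a' $ i * \<alpha> * b $ i)"
      unfolding sum_distrib_right sum_subtractf[symmetric]
      by (rule sum.cong) (simp_all only: left_diff_distrib right_diff_distrib mult_ac)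
    also have "trunc_scale \<dots> v = heis_act \<alpha> \<beta> \<gamma> x (heis_act \<alpha> \<beta> \<gamma> y v)
        - heis_act \<alpha> \<beta> \<gamma> y (heis_act \<alpha> \<beta> \<gamma> x v)"
      unfolding x y heis_act_eq by (rule commutator_parts [symmetric])
    finally show "heis_act \<alpha> \<beta> \<gamma> (heis_bracket x y) v = heis_act \<alpha> \<beta> \<gamma> x (heis_act \<alpha> \<beta> \<gamma> y v)
        - heis_act \<alpha> \<beta> \<gamma> y (heis_act \<alpha> \<beta> \<gamma> x v)" .
  qed
qed

section \<open>Irreducibility over K\<close>

lemma trunc_submodule_trivial:
  fixes W :: "('k::field, 'n::finite) trunc_poly set"
  assumes W: "trunc.subspace W"
    and mvar: "\<And>i v. v \<in> W \<Longrightarrow> trunc_mvar i v \<in> W"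
    and pderiv: "\<And>i v. v \<in> W \<Longrightarrow> trunc_pderiv i v \<in> W"
  shows "W = {0} \<or> W = UNIV"
proof (cases "W = {0}")
  case False
  define E where "E = (trunc_exps CHAR('k) :: ('n \<Rightarrow>\<^sub>0 nat) set)"
  define wt :: "('n \<Rightarrow>\<^sub>0 nat) \<Rightarrow> nat" where "wt e = (\<Sum>i\<in>UNIV. Poly_Mapping.lookup e i)" for e
  have wt_add: "wt (e + Poly_Mapping.single i 1) = Suc (wt e)" for e i
    by (simp add: wt_def lookup_add sum.distrib lookup_single when_def)
  \<comment> \<open>Descent on a strict bound \<open>N\<close> for the total degree of
    \<open>v\<close>; \<open>N = 0\<close> leaves no monomial at all.\<close>
  have one: "trunc_monom 0 \<in> W"
    if "v \<in> W" "v \<noteq> 0" "\<And>e. e \<in> E \<Longrightarrow> trunc_coeff v e \<noteq> 0 \<Longrightarrow> wt e < N" for v N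
    using that
  proof (induction N arbitrary: v)
    case 0
    then have "v = 0"
      by (intro trunc_poly_eqI) (auto simp: E_def)
    with 0 show ?case by simp
  next
    case (Suc N)
    show ?case
    proof (cases "\<exists>e\<in>E. e \<noteq> 0 \<and> trunc_coeff v e \<noteq> 0")
      case True
      then obtain e where e: "e \<in> E" "e \<noteq> 0" "trunc_coeff v e \<noteq> 0" by blast
      then obtain i where i: "Poly_Mapping.lookup e i \<noteq> 0"
        by (metis poly_mapping_eqI lookup_zero)
      define e' where "e' = e - Poly_Mapping.single i 1"
      have e': "e' + Poly_Mapping.single i 1 = e"
        using i unfolding e'_def
        by (intro poly_mapping_eqI) (auto simp: lookup_add lookup_minus lookup_single when_def)
      have i_less: "Poly_Mapping.lookup e i < CHAR('k)"
        using e(1) by (simp add: E_def trunc_exps_def)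
      have e'E: "e' \<in> E"
        using e(1) unfolding E_def trunc_exps_def e'_def
        by (auto simp: lookup_minus intro: le_less_trans[OF diff_le_self])
      have "Suc (Poly_Mapping.lookup e' i) = Poly_Mapping.lookup e i"
        unfolding e'[symmetric] by (simp add: lookup_add)
      \<comment> \<open>The exponent lies strictly between 0 and p, hence is not divisible by the
        characteristic; so the derivative keeps a nonzero coefficient at \<open>e'\<close>.\<close>
      moreover have "of_nat (Poly_Mapping.lookup e i) \<noteq> (0 :: 'k)"
        using i i_less by (auto simp: of_nat_eq_0_iff_char_dvd dest: dvd_imp_le)
      ultimately have "trunc_coeff (trunc_pderiv i v) e' \<noteq> 0"
        using e(3) e'E e' by (simp add: trunc_coeff_pderiv E_def del: of_nat_Suc)
      then have "trunc_pderiv i v \<noteq> 0" by auto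
      moreover have "wt d < N" if "d \<in> E" "trunc_coeff (trunc_pderiv i v) d \<noteq> 0" for d
      proof -
        have nz: "trunc_coeff v (d + Poly_Mapping.single i 1) \<noteq> 0"
          using that by (auto simp: trunc_coeff_pderiv E_def)
        \<comment> \<open>\<open>trunc_coeff\<close> vanishes outside \<open>E\<close>, so a nonzero
          value forces membership.\<close>
        then have "d + Poly_Mapping.single i 1 \<in> E"
          unfolding E_def by transfer (auto split: if_splits)
        from Suc.prems(3)[OF this nz] show ?thesis by (simp add: wt_add del: One_nat_def)
      qed
      ultimately show ?thesis
        using Suc.IH pderiv[OF Suc.prems(1)] by blast
    next
      case False
      \<comment> \<open>No nonconstant monomial occurs, so \<open>v\<close> is a nonzero constant
        and can be normalised.\<close>
      have v: "v = trunc_scale (trunc_coeff v 0) (trunc_monom 0)"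
        using False by (intro trunc_poly_eqI) (auto simp: trunc_coeff_scale trunc_coeff_monom E_def)
      with Suc.prems(2) have "trunc_coeff v 0 \<noteq> 0"
        by (metis trunc.scale_zero_left)
      then have "trunc_monom 0 = trunc_scale (inverse (trunc_coeff v 0)) v"
        by (subst v) simp
      then show ?thesis
        using trunc.subspace_scale[OF W Suc.prems(1)] by metis
    qed
  qed
  obtain v where v: "v \<in> W" "v \<noteq> 0"
    using False trunc.subspace_0[OF W] by auto
  have "finite E" by (simp add: E_def finite_trunc_exps)
  \<comment> \<open>A starting bound for the descent: only finitely many exponents carry
    coefficients.\<close>
  then have "wt e < Suc (Max (wt ` E))" if "e \<in> E" for e
    using that by (simp add: le_imp_less_Suc)
  with one[OF v] have one: "trunc_monom 0 \<in> W" by blast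
  \<comment> \<open>Ascent: induction on the total degree, adding one variable at a time.\<close>
  have monom: "trunc_monom e \<in> W" for e
  proof (induction "wt e" arbitrary: e)
    case 0
    then have "e = 0" by (intro poly_mapping_eqI) (simp add: wt_def)
    with one show ?case by simp
  next
    case (Suc N)
    then obtain i where i: "Poly_Mapping.lookup e i \<noteq> 0"
      by (metis wt_def sum.neutral Zero_not_Suc)
    have e: "e - Poly_Mapping.single i 1 + Poly_Mapping.single i 1 = e"
      using i by (intro poly_mapping_eqI) (auto simp: lookup_add lookup_minus lookup_single when_def)
    then have "wt (e - Poly_Mapping.single i 1) = N"
      using Suc.hyps(2) wt_add[of "e - Poly_Mapping.single i 1" i] by (metis Suc_inject)
    with Suc.hyps(1) mvar[of "trunc_monom (e - Poly_Mapping.single i 1)" i] e show ?case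
      by (simp add: trunc_mvar_monom)
  qed
  have "u \<in> W" for u
    by (subst trunc_poly_expand)
      (intro trunc.subspace_sum trunc.subspace_scale W monom)
  then show ?thesis by blast
qed simp

section \<open>Faithfulness over K\<close>

lemma trunc_coeff_der_part:
  fixes v :: "('k::field, 'n::finite) trunc_poly"
  assumes "e \<in> trunc_exps CHAR('k)"
  shows "trunc_coeff (der_part a v) e =
    (\<Sum>i\<in>UNIV. a i * (of_nat (Suc (Poly_Mapping.lookup e i))
       * trunc_coeff v (e + Poly_Mapping.single i 1)))"
  using assms by (simp add: der_part_def trunc_coeff_sum trunc_coeff_scale trunc_coeff_pderiv
      del: of_nat_Suc)

lemma trunc_coeff_mul_part_monom:
  fixes e e' :: "'n::finite \<Rightarrow>\<^sub>0 nat"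
  assumes "e' \<in> trunc_exps CHAR('k::field)"
  shows "trunc_coeff (mul_part b (trunc_monom e) :: ('k, 'n) trunc_poly) e' =
    (\<Sum>i\<in>UNIV. if e + Poly_Mapping.single i 1 = e' then b i else 0)"
  using assms unfolding mul_part_def trunc_coeff_sum
  by (intro sum.cong refl) (simp add: trunc_coeff_scale trunc_mvar_monom trunc_coeff_monom)

text \<open>The test vectors 1 and X_j determine \<open>x\<close>: the coefficient of X_j in x.1 is
  b_j, the constant term of x.X_j is a_j \<alpha>, and once \<open>a\<close> and \<open>b\<close>
  vanish the constant term of x.1 is t \<alpha>.\<close>

lemma heis_act_faithful:
  fixes \<alpha> :: "'k::field" and x :: "('k, 'n::finite) heis"
  assumes "\<alpha> \<noteq> 0" and char: "CHAR('k) > 1" and zero: "\<And>v. heis_act \<alpha> \<beta> \<gamma> x v = 0"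
  shows "x = 0"
proof -
  obtain a b t where x: "x = (a, b, t)" by (cases x)
  define s where "s = (\<Sum>i\<in>UNIV. a $ i * \<beta> i) + (\<Sum>i\<in>UNIV. b $ i * \<gamma> i) + t * \<alpha>"
  define \<delta> :: "'n \<Rightarrow> ('n \<Rightarrow>\<^sub>0 nat)" where "\<delta> i = Poly_Mapping.single i 1" for i
  have \<delta>_eq: "\<delta> i = \<delta> j \<longleftrightarrow> i = j" and \<delta>_0: "\<delta> i \<noteq> 0" "0 \<noteq> \<delta> i" for i j
    by (metis \<delta>_def lookup_single_eq lookup_single_not_eq lookup_zero zero_neq_one)+
  have \<delta>_add: "\<delta> j + \<delta> i \<noteq> 0" "0 \<noteq> \<delta> j + \<delta> i" for i j
    by (metis \<delta>_def add_is_0 lookup_add lookup_single_eq lookup_zero zero_neq_one)+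
  \<comment> \<open>Characteristic above 1 ensures that the variables themselves survive in the
    quotient.\<close>
  have \<delta>_mem: "\<delta> i \<in> trunc_exps CHAR('k)" and zero_mem: "0 \<in> trunc_exps CHAR('k)" for i
    using char by (simp_all add: \<delta>_def trunc_exps_def lookup_single when_def)
  have act: "trunc_coeff (trunc_scale s v) e + trunc_coeff (der_part (\<lambda>i. a $ i * \<alpha>) v) e
      + trunc_coeff (mul_part (\<lambda>i. b $ i) v) e = 0" for v e
    using zero[of v] by (simp add: x heis_act_eq s_def flip: trunc_coeff_add)
  have "b $ j = 0" for j
    using act[of "trunc_monom 0" "\<delta> j"] char
    by (simp add: trunc_coeff_scale trunc_coeff_monom trunc_coeff_der_part trunc_coeff_mul_part_monom
        \<delta>_mem \<delta>_0 \<delta>_eq \<delta>_add flip: \<delta>_def del: One_nat_def)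
  then have b: "b = 0" by (simp add: vec_eq_iff)
  have "a $ j * \<alpha> = 0" for j
    using act[of "trunc_monom (\<delta> j)" 0] char
    by (simp add: b trunc_coeff_scale trunc_coeff_monom trunc_coeff_der_part
        trunc_coeff_mul_part_monom zero_mem \<delta>_mem \<delta>_0 \<delta>_eq
        if_distrib[where f = "\<lambda>x. _ * x"] flip: \<delta>_def del: One_nat_def cong: if_cong)
  then have a: "a = 0" using \<open>\<alpha> \<noteq> 0\<close> by (simp add: vec_eq_iff)
  have "t * \<alpha> = 0"
    using act[of "trunc_monom 0" 0]
    by (simp add: a b s_def der_part_def mul_part_def trunc_coeff_scale trunc_coeff_monom zero_mem)
  with \<open>\<alpha> \<noteq> 0\<close> show ?thesis by (simp add: x a b zero_prod_def)
qed

section \<open>Dimension over K\<close>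

text \<open>Phrased for an indexed family so that the index set is counted directly; the same
  criterion serves over K and over F.\<close>

lemma (in vector_space) dim_UNIV_eq_card:
  assumes "finite I"
    and indep: "\<And>c. (\<Sum>i\<in>I. scale (c i) (w i)) = 0 \<Longrightarrow> \<forall>i\<in>I. c i = 0"
    and gen: "\<And>v. \<exists>c. v = (\<Sum>i\<in>I. scale (c i) (w i))"
  shows "dim UNIV = card I"
proof -
  have inj: "inj_on w I"
  proof (rule inj_onI, rule ccontr)
    fix i j
    assume ij: "i \<in> I" "j \<in> I" "w i = w j" "i \<noteq> j"
    \<comment> \<open>If \<open>w i = w j\<close>, the difference of the two indicators is a
      nontrivial relation.\<close>
    let ?c = "\<lambda>k. (if k = i then 1 else 0) - (if k = j then 1 else 0)"
    have "(\<Sum>k\<in>I. scale (?c k) (w k)) = 0"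
      using ij \<open>finite I\<close>
      by (simp add: scale_left_diff_distrib sum_subtractf if_distrib[where f = "\<lambda>x. scale x _"]
          cong: if_cong)
    from indep[OF this] ij show False by auto
  qed
  have "independent (w ` I)"
    using indep[of "\<lambda>i. u (w i)" for u] \<open>finite I\<close>
    by (subst dependent_finite) (auto simp: sum.reindex[OF inj])
  moreover have "span (w ` I) = UNIV"
  proof -
    have "v \<in> span (w ` I)" for v
    proof -
      obtain c where "v = (\<Sum>i\<in>I. scale (c i) (w i))" using gen by blast
      then show ?thesis by (simp add: span_sum span_scale span_base)
    qed
    then show ?thesis by blast
  qed
  ultimately have "dim UNIV = card (w ` I)"
    by (intro dim_eq_card) simp_all
  with inj show ?thesis by (simp add: card_image)
qed

text \<open>Reads off coefficients and thereby yields independence over K; over F it is applied with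
  \<open>c e\<close> expanded in powers of \<alpha>.\<close>

lemma trunc_monom_coeff_sum:
  fixes c :: "('n::finite \<Rightarrow>\<^sub>0 nat) \<Rightarrow> 'k::field"
  assumes "e \<in> trunc_exps CHAR('k)"
  shows "trunc_coeff (\<Sum>e\<in>trunc_exps CHAR('k). trunc_scale (c e) (trunc_monom e)) e = c e"
  using assms
  by (simp add: trunc_coeff_sum trunc_coeff_scale trunc_coeff_monom finite_trunc_exps
      if_distrib[where f = "\<lambda>x. _ * x"] cong: if_cong)

lemma dim_trunc_poly:
  "trunc.dim (UNIV :: ('k::field, 'n::finite) trunc_poly set) = CHAR('k) ^ CARD('n)"
proof -
  have "trunc.dim (UNIV :: ('k, 'n) trunc_poly set)
      = card (trunc_exps CHAR('k) :: ('n \<Rightarrow>\<^sub>0 nat) set)"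
  proof (rule trunc.dim_UNIV_eq_card[where w = trunc_monom])
    fix c :: "('n \<Rightarrow>\<^sub>0 nat) \<Rightarrow> 'k"
    assume "(\<Sum>e\<in>trunc_exps CHAR('k). trunc_scale (c e) (trunc_monom e)) = 0"
    then show "\<forall>e\<in>trunc_exps CHAR('k). c e = 0"
      by (metis trunc_monom_coeff_sum trunc_coeff_0)
  qed (use trunc_poly_expand finite_trunc_exps in blast)+
  then show ?thesis by (simp add: card_trunc_exps)
qed

section \<open>Evaluation at \<alpha> and the power basis of K over F\<close>

context field_extension
begin

lemma hom_eq_0_iff: "\<iota> x = 0 \<longleftrightarrow> x = 0"
proof
  assume "\<iota> x = 0"
  then have "\<iota> (x * inverse x) = 0" by (simp add: hom_mult)
  then show "x = 0" using hom_one by (cases "x = 0") auto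
qed (simp add: hom_zero)

lemma hom_of_nat: "\<iota> (of_nat n) = of_nat n"
  by (induction n) (simp_all add: hom_zero hom_one hom_add)

text \<open>\<open>\<iota>\<close> is injective and respects multiples of 1. The link is needed
  because the theorem fixes the characteristic of F, whereas truncation uses that of K.\<close>

lemma CHAR_eq: "CHAR('k) = CHAR('f)"
proof (rule CHAR_eqI)
  show "of_nat CHAR('f) = (0 :: 'k)"
    by (metis hom_of_nat hom_zero of_nat_CHAR)
  fix n
  assume "of_nat n = (0 :: 'k)"
  then have "\<iota> (of_nat n) = 0" by (simp add: hom_of_nat)
  then show "CHAR('f) dvd n" by (simp add: hom_eq_0_iff of_nat_eq_0_iff_char_dvd)
qed

text \<open>Horner recursion, on which the inductions over polynomials below rest.\<close>

lemma eval_at_pCons: "eval_at \<iota> \<alpha> (pCons a q) = \<iota> a + \<alpha> * eval_at \<iota> \<alpha> q"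
  by (simp add: eval_at_def map_poly_pCons hom_zero)

lemma eval_at_0: "eval_at \<iota> \<alpha> 0 = 0"
  by (simp add: eval_at_def)

lemma eval_at_add: "eval_at \<iota> \<alpha> (q + r) = eval_at \<iota> \<alpha> q + eval_at \<iota> \<alpha> r"
  by (induction q r rule: poly_induct2) (simp_all add: eval_at_pCons eval_at_0 hom_add distrib_left add_ac)

lemma eval_at_smult: "eval_at \<iota> \<alpha> (smult c q) = \<iota> c * eval_at \<iota> \<alpha> q"
  by (induction q)
    (simp_all only: smult_0_right smult_pCons eval_at_pCons eval_at_0 hom_mult distrib_left
      mult.left_commute mult_zero_right)

lemma eval_at_mult: "eval_at \<iota> \<alpha> (q * r) = eval_at \<iota> \<alpha> q * eval_at \<iota> \<alpha> r"
  by (induction q)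
    (simp_all only: mult_zero_left mult_pCons_left eval_at_pCons eval_at_0 eval_at_add eval_at_smult
      hom_zero distrib_right mult.assoc add_0_left)

lemma eval_at_monom: "eval_at \<iota> \<alpha> (monom c j) = \<iota> c * \<alpha> ^ j"
  by (induction j)
    (simp_all only: monom_Suc monom_0 eval_at_pCons eval_at_0 hom_zero mult.left_commute power_0
      power_Suc add_0_left add_0_right mult_zero_right mult_1_right)

lemma eval_at_sum: "eval_at \<iota> \<alpha> (sum h A) = (\<Sum>x\<in>A. eval_at \<iota> \<alpha> (h x))"
  by (induction A rule: infinite_finite_induct) (simp_all add: eval_at_0 eval_at_add)

text \<open>The hypothesis on coefficients covers a zero remainder uniformly, which a strict degree
  bound would exclude for \<open>m = 0\<close>.\<close>

lemma eval_at_low_degree: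
  assumes "\<And>j. j \<ge> m \<Longrightarrow> coeff r j = 0"
  shows "eval_at \<iota> \<alpha> r = (\<Sum>j<m. \<iota> (coeff r j) * \<alpha> ^ j)"
proof -
  have "r = (\<Sum>j<m. monom (coeff r j) j)"
    using assms by (intro poly_eqI) (auto simp: coeff_sum not_less)
  then have "eval_at \<iota> \<alpha> r = eval_at \<iota> \<alpha> (\<Sum>j<m. monom (coeff r j) j)" by simp
  then show ?thesis by (simp add: eval_at_sum eval_at_monom)
qed

text \<open>Division by the minimal polynomial leaves a remainder with the same value at \<alpha>
  and no coefficients from index \<open>m\<close> on.\<close>

lemma simple_ext_powers_generate:
  assumes "algebraic_of_degree \<iota> \<alpha> m" and "k \<in> simple_ext \<iota> \<alpha>"
  shows "\<exists>c. k = (\<Sum>j<m. \<iota> (c j) * \<alpha> ^ j)"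
proof -
  obtain q where q: "is_min_poly \<iota> \<alpha> q" "degree q = m"
    using assms(1) by (auto simp: algebraic_of_degree_def)
  obtain h where h: "k = eval_at \<iota> \<alpha> h"
    using assms(2) by (auto simp: simple_ext_def)
  have "q \<noteq> 0" using q(1) by (auto simp: is_min_poly_def)
  have "eval_at \<iota> \<alpha> (h div q * q + h mod q) = eval_at \<iota> \<alpha> (h mod q)"
    unfolding eval_at_add eval_at_mult using q(1) by (simp add: is_min_poly_def)
  moreover have "coeff (h mod q) j = 0" if "j \<ge> m" for j
    using degree_mod_less[OF \<open>q \<noteq> 0\<close>, of h] that q(2) by (auto intro: coeff_eq_0)
  ultimately have "k = (\<Sum>j<m. \<iota> (coeff (h mod q) j) * \<alpha> ^ j)"
    by (simp add: h eval_at_low_degree)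
  then show ?thesis by blast
qed

text \<open>A nontrivial relation would be a nonzero polynomial vanishing at \<alpha> with degree
  below that of the minimal polynomial.\<close>

lemma powers_independent:
  assumes "algebraic_of_degree \<iota> \<alpha> m" and "(\<Sum>j<m. \<iota> (c j) * \<alpha> ^ j) = 0" and "j < m"
  shows "c j = 0"
proof (rule ccontr)
  assume nz: "c j \<noteq> 0"
  obtain q where q: "is_min_poly \<iota> \<alpha> q" "degree q = m"
    using assms(1) by (auto simp: algebraic_of_degree_def)
  define r where "r = (\<Sum>j<m. monom (c j) j)"
  have coeff_r: "coeff r i = (if i < m then c i else 0)" for i
    by (simp add: r_def coeff_sum)
  have "eval_at \<iota> \<alpha> r = 0"
    using assms(2) by (simp add: r_def eval_at_sum eval_at_monom)
  moreover have "r \<noteq> 0" using coeff_r[of j] nz assms(3) by auto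
  ultimately have "m \<le> degree r" using q by (simp add: is_min_poly_def)
  then have "lead_coeff r = 0" by (simp add: coeff_r)
  with \<open>r \<noteq> 0\<close> show False by simp
qed

section \<open>Restriction of scalars to F\<close>

lemma vector_space_restrict:
  assumes "vector_space s"
  shows "vector_space (restrict_scalars \<iota> s)"
proof -
  interpret vector_space s by (rule assms)
  show ?thesis
    by unfold_locales
      (simp_all add: restrict_scalars_def hom_one hom_add hom_mult scale_left_distrib
        scale_right_distrib)
qed

lemma lie_module_restrict:
  fixes act :: "('k, 'n::finite) heis \<Rightarrow> 'v::ab_group_add \<Rightarrow> 'v"
  assumes "lie_module heis_scale heis_bracket s act"
  shows "lie_module heis_scale heis_bracket (restrict_scalars \<iota> s) (restrict_act \<iota> act)"
proof -
  interpret M: lie_module heis_scale heis_bracket s act by (rule assms)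
  interpret V: vector_space "restrict_scalars \<iota> s"
    by (rule vector_space_restrict) (rule M.V.vector_space_axioms)
  interpret H: lie_algebra "heis_scale :: 'f \<Rightarrow> ('f, 'n) heis \<Rightarrow> _" heis_bracket
    by (rule lie_algebra_heis)
  interpret left: Vector_Spaces.linear heis_scale s "\<lambda>x. act x v" for v
    by (rule M.act_linear_left)
  interpret right: Vector_Spaces.linear s s "act x" for x
    by (rule M.act_linear_right)
  show ?thesis
    by unfold_locales
      (simp_all add: restrict_act_def restrict_scalars_def heis_incl_add heis_incl_scale
        heis_incl_bracket left.add left.scale right.add right.scale M.act_bracket)
qed

text \<open>Every K-submodule is in particular an F-submodule, so irreducibility passes upwards from
  F to K.\<close>

lemma irreducible_of_restrict:
  fixes act :: "('k, 'n::finite) heis \<Rightarrow> 'v::ab_group_add \<Rightarrow> 'v"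
  assumes "lie_module heis_scale heis_bracket s act"
    and "irreducible_lie_module heis_scale heis_bracket (restrict_scalars \<iota> s) (restrict_act \<iota> act)"
  shows "irreducible_lie_module heis_scale heis_bracket s act"
proof -
  interpret M: lie_module heis_scale heis_bracket s act by (rule assms)
  interpret R: irreducible_lie_module heis_scale heis_bracket "restrict_scalars \<iota> s" "restrict_act \<iota> act"
    by (rule assms)
  show ?thesis
  proof
    show "(UNIV :: 'v set) \<noteq> {0}" by (rule R.nontrivial)
    fix W
    assume "M.submodule W"
    then have "R.submodule W"
      unfolding M.submodule_def R.submodule_def M.V.subspace_def R.V.subspace_def
        restrict_scalars_def restrict_act_def by blast
    then show "W = {0} \<or> W = UNIV" by (rule R.irreducible)
  qed
qed

lemma irreducible_restrict_heis_act:
  fixes \<alpha> :: 'k and \<beta> \<gamma> :: "'n::finite \<Rightarrow> 'k"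
  assumes "\<alpha> \<noteq> 0" and "CHAR('k) > 0" and ext: "simple_ext \<iota> \<alpha> = UNIV"
  shows "irreducible_lie_module heis_scale heis_bracket
    (restrict_scalars \<iota> trunc_scale) (restrict_act \<iota> (heis_act \<alpha> \<beta> \<gamma>))"
proof -
  let ?act = "restrict_act \<iota> (heis_act \<alpha> \<beta> \<gamma>)"
  interpret M: lie_module heis_scale heis_bracket "restrict_scalars \<iota> trunc_scale" ?act
    by (rule lie_module_restrict) (rule lie_module_heis_act)
  show ?thesis
  proof
    have "trunc_coeff (trunc_monom 0 :: ('k, 'n) trunc_poly) 0 \<noteq> 0"
      using assms(2) by (simp add: trunc_coeff_monom trunc_exps_def)
    then have "trunc_monom 0 \<noteq> (0 :: ('k, 'n) trunc_poly)" by auto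
    then show "(UNIV :: ('k, 'n) trunc_poly set) \<noteq> {0}" by blast
  next
    fix W :: "('k, 'n) trunc_poly set"
    assume "M.submodule W"
    then have W: "M.V.subspace W" and stable: "\<And>x w. w \<in> W \<Longrightarrow> ?act x w \<in> W"
      by (auto simp: M.submodule_def)
    have alpha: "trunc_scale \<alpha> w \<in> W" if "w \<in> W" for w
      using stable[OF that, of heis_z] by (simp add: restrict_act_def heis_incl_basis heis_act_basis)
    \<comment> \<open>By Horner's scheme, stability under F and under z suffices for every
      polynomial in \<alpha>, hence for all of K.\<close>
    have "trunc_scale (eval_at \<iota> \<alpha> q) w \<in> W" if "w \<in> W" for q w
      using that
    proof (induction q arbitrary: w)
      case 0
      show ?case by (simp add: eval_at_0 M.V.subspace_0[OF W])
    next
      case (pCons a q)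
      have "trunc_scale (\<iota> a) w \<in> W"
        using M.V.subspace_scale[OF W pCons.prems] by (simp add: restrict_scalars_def)
      moreover have "trunc_scale (\<alpha> * eval_at \<iota> \<alpha> q) w \<in> W"
        using alpha[OF pCons.IH[OF pCons.prems]] by simp
      ultimately show ?case
        by (simp add: eval_at_pCons trunc.scale_left_distrib M.V.subspace_add[OF W])
    qed
    then have scale: "trunc_scale c w \<in> W" if "w \<in> W" for c w
      using ext that unfolding simple_ext_def by (metis UNIV_I imageE)
    have sub: "trunc.subspace W"
      using W scale by (simp add: trunc.subspace_def M.V.subspace_def)
    \<comment> \<open>With all of K available, subtracting the scalar part of y_i isolates
      multiplication by X_i; x_i is treated likewise, followed by division by \<alpha>.\<close>
    have "trunc_mvar i w \<in> W" if "w \<in> W" for i w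
    proof -
      have "trunc_scale (\<gamma> i) w + trunc_mvar i w \<in> W"
        using stable[OF that, of "heis_y i"]
        by (simp add: restrict_act_def heis_incl_basis heis_act_basis)
      from trunc.subspace_diff[OF sub this scale[OF that]] show ?thesis
        by (metis add_diff_cancel_left')
    qed
    moreover have "trunc_pderiv i w \<in> W" if "w \<in> W" for i w
    proof -
      have "trunc_scale (\<beta> i) w + trunc_scale \<alpha> (trunc_pderiv i w) \<in> W"
        using stable[OF that, of "heis_x i"]
        by (simp add: restrict_act_def heis_incl_basis heis_act_basis)
      from trunc.subspace_diff[OF sub this scale[OF that]]
      have "trunc_scale \<alpha> (trunc_pderiv i w) \<in> W"
        by (metis add_diff_cancel_left')
      from scale[OF this, of "inverse \<alpha>"] \<open>\<alpha> \<noteq> 0\<close> show ?thesis by simp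
    qed
    ultimately show "W = {0} \<or> W = UNIV"
      using sub by (intro trunc_submodule_trivial)
  qed
qed

text \<open>Faithfulness over K is inherited because \<open>heis_incl\<close> has trivial kernel,
  \<open>\<iota>\<close> being injective.\<close>

lemma faithful_restrict_heis_act:
  fixes \<alpha> :: 'k and \<beta> \<gamma> :: "'n::finite \<Rightarrow> 'k"
  assumes "\<alpha> \<noteq> 0" and "CHAR('k) > 1"
  shows "faithful_lie_module heis_scale heis_bracket
    (restrict_scalars \<iota> trunc_scale) (restrict_act \<iota> (heis_act \<alpha> \<beta> \<gamma>))"
proof (intro faithful_lie_module.intro faithful_lie_module_axioms.intro lie_module_restrict
    lie_module_heis_act)
  fix x :: "('f, 'n) heis"
  assume "\<forall>v. restrict_act \<iota> (heis_act \<alpha> \<beta> \<gamma>) x v = 0"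
  then have "heis_incl \<iota> x = 0"
    using assms by (intro heis_act_faithful[of \<alpha> \<beta> \<gamma>]) (simp_all add: restrict_act_def)
  then show "x = 0"
    by (auto simp: heis_incl_def case_prod_beta prod_eq_iff vec_eq_iff hom_eq_0_iff)
qed

text \<open>The tower argument: products of the K-basis of monomials with the F-basis of powers of
  \<alpha> form an F-basis.\<close>

lemma dim_restrict_trunc_poly:
  fixes \<alpha> :: 'k
  assumes deg: "algebraic_of_degree \<iota> \<alpha> m" and ext: "simple_ext \<iota> \<alpha> = UNIV"
  shows "vector_space.dim (restrict_scalars \<iota> trunc_scale) (UNIV :: ('k, 'n::finite) trunc_poly set)
    = CHAR('k) ^ CARD('n) * m"
proof -
  interpret V: vector_space "restrict_scalars \<iota> (trunc_scale :: 'k \<Rightarrow> ('k, 'n) trunc_poly \<Rightarrow> _)"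
    by (rule vector_space_restrict) (rule vector_space_trunc)
  let ?E = "trunc_exps CHAR('k) :: ('n \<Rightarrow>\<^sub>0 nat) set"
  let ?w = "\<lambda>(e, j). trunc_scale (\<alpha> ^ j) (trunc_monom e) :: ('k, 'n) trunc_poly"
  \<comment> \<open>Grouping by the exponent \<open>e\<close> turns an F-combination of the products
    into a K-combination of monomials.\<close>
  have sum_eq: "(\<Sum>x\<in>?E \<times> {..<m}. restrict_scalars \<iota> trunc_scale (c x) (?w x))
      = (\<Sum>e\<in>?E. trunc_scale (\<Sum>j<m. \<iota> (c (e, j)) * \<alpha> ^ j) (trunc_monom e))" for c
    by (simp add: sum.cartesian_product restrict_scalars_def trunc.scale_sum_left case_prod_beta)
  have "V.dim UNIV = card (?E \<times> {..<m})"
  proof (rule V.dim_UNIV_eq_card[where w = ?w])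
    fix c
    assume "(\<Sum>x\<in>?E \<times> {..<m}. restrict_scalars \<iota> trunc_scale (c x) (?w x)) = 0"
    then have "(\<Sum>j<m. \<iota> (c (e, j)) * \<alpha> ^ j) = 0" if "e \<in> ?E" for e
      using trunc_monom_coeff_sum[OF that, of "\<lambda>e. \<Sum>j<m. \<iota> (c (e, j)) * \<alpha> ^ j"]
      by (simp only: sum_eq trunc_coeff_0)
    with powers_independent[OF deg] show "\<forall>x\<in>?E \<times> {..<m}. c x = 0"
      by fastforce
  next
    fix v :: "('k, 'n) trunc_poly"
    have "\<exists>c. k = (\<Sum>j<m. \<iota> (c j) * \<alpha> ^ j)" for k
      using simple_ext_powers_generate[OF deg] ext by blast
    \<comment> \<open>\<open>c k\<close> chooses F-coordinates of each \<open>k\<close> in K; they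
      are then applied to the coefficients of \<open>v\<close>.\<close>
    then obtain c where "\<And>k. k = (\<Sum>j<m. \<iota> (c k j) * \<alpha> ^ j)"
      by metis
    then have "v = (\<Sum>x\<in>?E \<times> {..<m}. restrict_scalars \<iota> trunc_scale
        ((\<lambda>(e, j). c (trunc_coeff v e) j) x) (?w x))"
      unfolding sum_eq using trunc_poly_expand[of v] by simp
    then show "\<exists>c. v = (\<Sum>x\<in>?E \<times> {..<m}. restrict_scalars \<iota> trunc_scale (c x) (?w x))"
      by blast
  qed (simp add: finite_trunc_exps)
  then show ?thesis by (simp add: card_cartesian_product card_trunc_exps)
qed

end

theorem corollary4p3:
  fixes \<iota> :: "'f::field \<Rightarrow> 'k::field"
    and \<alpha> :: 'k
    and f g :: "'n::finite \<Rightarrow> 'f poly"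
    and p m :: nat
  assumes "prime p" and "CHAR('f) = p"
    and "field_extension \<iota>"
    and "\<alpha> \<noteq> 0"
    and "algebraic_of_degree \<iota> \<alpha> m"
    and "simple_ext \<iota> \<alpha> = (UNIV :: 'k set)"
  shows
    "let act = heis_act \<alpha> (\<lambda>i. eval_at \<iota> \<alpha> (f i)) (\<lambda>i. eval_at \<iota> \<alpha> (g i));
         act\<^sub>F = restrict_act \<iota> act;
         scale\<^sub>F = restrict_scalars \<iota> trunc_scale;
         V = (UNIV :: ('k, 'n) trunc_poly set)
     in irreducible_lie_module heis_scale heis_bracket trunc_scale act \<and>
        vector_space.dim trunc_scale V = p ^ CARD('n) \<and>
        faithful_lie_module heis_scale heis_bracket scale\<^sub>F act\<^sub>F \<and>
        irreducible_lie_module heis_scale heis_bracket scale\<^sub>F act\<^sub>F \<and>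
        vector_space.dim scale\<^sub>F V = p ^ CARD('n) * m"
proof -
  interpret field_extension \<iota> by fact
  have char: "CHAR('k) = p"
    using assms(2) by (simp add: CHAR_eq)
  have p: "CHAR('k) > 0" "CHAR('k) > 1"
    using prime_gt_1_nat[OF assms(1)] by (simp_all add: char)
  \<comment> \<open>Irreducibility over F comes first and also yields irreducibility over K.\<close>
  note irr = irreducible_restrict_heis_act[OF assms(4) p(1) assms(6)]
  show ?thesis
    unfolding Let_def char[symmetric]
    by (intro conjI irreducible_of_restrict[OF lie_module_heis_act irr] irr dim_trunc_poly
        faithful_restrict_heis_act dim_restrict_trunc_poly[OF assms(5,6)] assms p)
qed

end
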